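(* Let $I,J\subseteq\mathbb{R}$ be open intervals, let $f:I\to J$ be an infinitely differentiable bijection whose inverse $y=f^{-1}:J\to I$ is also infinitely differentiable, let $F^{\Delta}(n,m,x)$ ($x\in I$) be the composita of $f$, and let $Y^{\Delta}(n,m,x)$ ($x\in J$) be the composita of the inverse function $y$. Then the following recurrent expressions hold for all integers $n\ge m\ge 1$. (1) For all $x\in J$, $$Y^{\Delta}(n,m,x)=\begin{cases}\dfrac{1}{F^{\Delta}(m,m,y(x))}, & n=m,\\[2ex] -\dfrac{1}{F^{\Delta}(m,m,y(x))}\displaystyle\sum_{k=m+1}^{n}Y^{\Delta}(n,k,x)\,F^{\Delta}(k,m,y(x)), & n>m.\end{cases}$$ (2) For all $x\in I$, $$Y^{\Delta}(n,m,f(x))=\begin{cases}\dfrac{1}{F^{\Delta}(n,n,x)}, & n=m,\\[2ex] -\dfrac{1}{F^{\Delta}(n,n,x)}\displaystyle\sum_{k=m}^{n-1}F^{\Delta}(n,k,x)\,Y^{\Delta}(k,m,f(x)), & n>m.\end{cases}$$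
   Context: For an infinitely differentiable function $h$, the composita of $h$ means the composita of the generating function $h(x+z)-h(x)=\sum_{n\ge 1}\frac{h^{(n)}(x)}{n!}z^n$ (a formal power series in $z$), which is the array $$H^{\Delta}(n,k,x)=\sum_{\substack{\lambda_1+\cdots+\lambda_k=n\\ \lambda_1,\dots,\lambda_k\ge 1}}\frac{h^{(\lambda_1)}(x)}{\lambda_1!}\cdots\frac{h^{(\lambda_k)}(x)}{\lambda_k!},\qquad n\ge k\ge 1,$$ the sum being over all compositions of $n$ into exactly $k$ positive parts; equivalently, $[h(x+z)-h(x)]^k=\sum_{n\ge k}H^{\Delta}(n,k,x)z^n$. *)

theory Defs
  imports "HOL-Analysis.Analysis"
begin

text \<open>Intended for open \<open>S\<close>: the two-sided derivatives taken by \<^const>\<open>deriv\<close> at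
  points of \<open>S\<close> then depend only on the values of \<open>h\<close> on \<open>S\<close>.\<close>

definition smooth_on :: "real set \<Rightarrow> (real \<Rightarrow> real) \<Rightarrow> bool" where
  "smooth_on S h \<longleftrightarrow> (\<forall>n. \<forall>x\<in>S. (deriv ^^ n) h differentiable (at x))"

definition compositions :: "nat \<Rightarrow> nat \<Rightarrow> nat list set" where
  "compositions n k = {ls. length ls = k \<and> sum_list ls = n \<and> (\<forall>l\<in>set ls. 1 \<le> l)}"

lemma finite_compositions: "finite (compositions n k)"
proof (rule finite_subset)
  show "compositions n k \<subseteq> {ls. set ls \<subseteq> {..n} \<and> length ls = k}"
    by (auto simp: compositions_def intro: member_le_sum_list)
  show "finite {ls. set ls \<subseteq> {..n} \<and> length ls = k}"
    by (rule finite_lists_length_eq) simp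
qed

definition composita :: "(real \<Rightarrow> real) \<Rightarrow> nat \<Rightarrow> nat \<Rightarrow> real \<Rightarrow> real" where
  "composita h n k x =
     (\<Sum>ls\<in>compositions n k. \<Prod>l\<leftarrow>ls. (deriv ^^ l) h x / fact l)"

end

theory Submission
  imports Defs
begin

unbundle no vec_syntax
unbundle fps_syntax

text \<open>A family of formal power series \<open>G x\<close> consists of the Taylor series of a smooth function
  exactly when the coefficientwise derivative of \<open>G\<close> in the base point \<open>x\<close> is the formal derivative
  of \<open>G x\<close>; such a family is determined by its constant coefficients. This property is stable under
  composition, so \<open>f (y x) = x\<close> forces the composition of the Taylor series to be \<open>fps_X\<close>. As the
  compositae are the coefficients of the powers of the series without constant term, comparing
  coefficients in \<open>F ^ m oo Y = fps_X ^ m\<close> and \<open>Y ^ m oo F = fps_X ^ m\<close> gives the two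
  recurrences.\<close>

section \<open>Taylor families and their uniqueness\<close>

definition taylor_family :: "real set \<Rightarrow> (real \<Rightarrow> real fps) \<Rightarrow> bool" where
  "taylor_family S G \<longleftrightarrow>
     (\<forall>x\<in>S. \<forall>n. ((\<lambda>x. G x $ n) has_real_derivative fps_deriv (G x) $ n) (at x))"

definition taylor :: "(real \<Rightarrow> real) \<Rightarrow> real \<Rightarrow> real fps" where
  "taylor h x = Abs_fps (\<lambda>n. (deriv ^^ n) h x / fact n)"

text \<open>This is the series of \<open>h (x + z) - h x\<close> in \<open>z\<close>, whose powers
  generate the composita. Its vanishing constant term lets it serve as the inner series of
  \<open>oo\<close>.\<close>

definition taylor0 :: "(real \<Rightarrow> real) \<Rightarrow> real \<Rightarrow> real fps" where
  "taylor0 h x = taylor h x - fps_const (h x)"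

lemma taylor_nth_0 [simp]: "taylor h x $ 0 = h x"
  by (simp add: taylor_def)

lemma taylor0_nth_0 [simp]: "taylor0 h x $ 0 = 0"
  by (simp add: taylor0_def)

lemma taylor_family_taylor:
  assumes "smooth_on S h"
  shows "taylor_family S (taylor h)"
  unfolding taylor_family_def
proof (intro ballI allI)
  fix x n assume "x \<in> S"
  then have "(deriv ^^ n) h differentiable (at x)"
    using assms by (simp add: smooth_on_def)
  then have "((deriv ^^ n) h has_real_derivative deriv ((deriv ^^ n) h) x) (at x)"
    by (simp add: DERIV_deriv_iff_real_differentiable)
  from DERIV_cdivide[OF this, of "fact n"]
  show "((\<lambda>x. taylor h x $ n) has_real_derivative fps_deriv (taylor h x) $ n) (at x)"
    by (simp add: taylor_def field_simps del: of_nat_Suc)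
qed

lemma taylor_family_id: "taylor_family S (\<lambda>x. fps_const x + fps_X)"
  unfolding taylor_family_def
proof (intro ballI allI)
  fix x :: real and n
  show "((\<lambda>x. (fps_const x + fps_X) $ n) has_real_derivative fps_deriv (fps_const x + fps_X) $ n)
          (at x)"
    by (cases n) (auto simp: fps_X_def intro!: derivative_eq_intros)
qed

text \<open>Differentiating coefficient \<open>n\<close> in the base point gives
  \<open>Suc n\<close> times coefficient \<open>Suc n\<close>, so each coefficient function
  determines the next. Openness of \<open>S\<close> makes equality on \<open>S\<close> an equality
  near \<open>x\<close>, hence one of derivatives.\<close>

lemma taylor_family_unique:
  assumes "open S" "taylor_family S G" "taylor_family S H"
    and eq: "\<And>x. x \<in> S \<Longrightarrow> G x $ 0 = H x $ 0"
    and "x \<in> S"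
  shows "G x = H x"
proof (rule fps_ext)
  fix n
  show "G x $ n = H x $ n"
    using \<open>x \<in> S\<close>
  proof (induction n arbitrary: x)
    case 0
    then show ?case by (rule eq)
  next
    case (Suc n)
    have "((\<lambda>x. G x $ n) has_real_derivative fps_deriv (G x) $ n) (at x)"
      using assms(2) Suc.prems by (simp add: taylor_family_def)
    moreover have "((\<lambda>x. G x $ n) has_real_derivative fps_deriv (H x) $ n) (at x)"
    proof (rule has_field_derivative_transform_within_open)
      show "((\<lambda>x. H x $ n) has_real_derivative fps_deriv (H x) $ n) (at x)"
        using assms(3) Suc.prems by (simp add: taylor_family_def)
    qed (use assms(1) Suc in auto)
    ultimately have "fps_deriv (G x) $ n = fps_deriv (H x) $ n"
      by (rule DERIV_unique)
    then show ?case by (simp del: of_nat_Suc)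
  qed
qed

section \<open>Base-point derivatives of products, powers and compositions\<close>

lemma has_real_derivative_fps_mult_nth:
  assumes "\<And>n. ((\<lambda>x. G x $ n) has_real_derivative G' $ n) (at x)"
    and "\<And>n. ((\<lambda>x. H x $ n) has_real_derivative H' $ n) (at x)"
  shows "((\<lambda>x. (G x * H x) $ n) has_real_derivative (G' * H x + G x * H') $ n) (at x)"
  unfolding fps_mult_nth fps_add_nth sum.distrib[symmetric]
  by (rule derivative_eq_intros assms refl)+ (simp add: algebra_simps)

lemma has_real_derivative_fps_power_nth:
  assumes "\<And>n. ((\<lambda>x. G x $ n) has_real_derivative G' $ n) (at x)"
  shows "((\<lambda>x. (G x ^ k) $ n) has_real_derivative (of_nat k * G x ^ (k - 1) * G') $ n) (at x)"
proof (induction k arbitrary: n)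
  case 0
  then show ?case by simp
next
  case (Suc k)
  \<comment> \<open>The split on \<open>k\<close> deals with the truncated \<open>k - 1\<close>: at
    \<open>k = 0\<close> the factor \<open>of_nat k\<close> kills that term.\<close>
  have "G' * G x ^ k + G x * (of_nat k * G x ^ (k - 1) * G') = of_nat (Suc k) * G x ^ k * G'"
    by (cases k) (simp_all add: algebra_simps)
  with has_real_derivative_fps_mult_nth[OF assms Suc] show ?case
    by (simp only: diff_Suc_1 power_Suc)
qed

text \<open>Since \<open>b ^ i\<close> starts at degree \<open>i\<close>, the sum for every
  coefficient \<open>j\<close> up to \<open>n\<close> can be extended to the common range
  \<open>0..n\<close>. The two summations can then be swapped.\<close>

lemma fps_compose_mult_nth:
  fixes a b c :: "real fps"
  assumes "b $ 0 = 0"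
  shows "((a oo b) * c) $ n = (\<Sum>i=0..n. a $ i * (b ^ i * c) $ n)"
proof -
  have "(a oo b) $ j = (\<Sum>i=0..n. a $ i * (b ^ i) $ j)" if "j \<le> n" for j
    unfolding fps_compose_nth
    by (rule sum.mono_neutral_left) (use that startsby_zero_power_prefix[OF assms] in auto)
  then have "((a oo b) * c) $ n = (\<Sum>j=0..n. \<Sum>i=0..n. a $ i * (b ^ i) $ j * c $ (n - j))"
    by (simp add: fps_mult_nth sum_distrib_right)
  also have "\<dots> = (\<Sum>i=0..n. \<Sum>j=0..n. a $ i * (b ^ i) $ j * c $ (n - j))"
    by (rule sum.swap)
  finally show ?thesis
    by (simp add: fps_mult_nth sum_distrib_left mult.assoc)
qed

text \<open>Moving the base point changes both the outer series and the centred inner series. By the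
  chain and product rules these changes contribute the two parts, \<open>fps_const d\<close> and
  \<open>E\<close>, of the inner derivative in the formal chain rule.\<close>

lemma taylor_family_compose:
  assumes F: "taylor_family T F" and G: "taylor_family S G"
    and ran: "\<And>x. x \<in> S \<Longrightarrow> G x $ 0 \<in> T"
  shows "taylor_family S (\<lambda>x. F (G x $ 0) oo (G x - fps_const (G x $ 0)))"
  unfolding taylor_family_def
proof (intro ballI allI)
  fix x n assume x: "x \<in> S"
  define A where "A = (\<lambda>x. G x - fps_const (G x $ 0))"
  define d where "d = fps_deriv (G x) $ 0"
  \<comment> \<open>\<open>E\<close> is the base-point derivative of \<open>A x\<close>: centring
    removes the derivative \<open>d\<close> of the constant term.\<close>
  define E where "E = fps_deriv (G x) - fps_const d"
  define P where "P = F (G x $ 0)"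
  have A0: "A x $ 0 = 0" by (simp add: A_def)
  have E0: "E $ 0 = 0" by (simp add: E_def d_def)
  have dG: "((\<lambda>x. G x $ k) has_real_derivative fps_deriv (G x) $ k) (at x)" for k
    using G x by (simp add: taylor_family_def)
  have dA: "((\<lambda>x. A x $ k) has_real_derivative E $ k) (at x)" for k
    using dG[of k] by (cases k) (auto simp: A_def E_def d_def)
  have dF: "((\<lambda>x. F (G x $ 0) $ i) has_real_derivative fps_deriv P $ i * d) (at x)" for i
  proof -
    have "((\<lambda>z. F z $ i) has_real_derivative fps_deriv P $ i) (at (G x $ 0))"
      using F ran[OF x] by (simp add: taylor_family_def P_def)
    from DERIV_chain2[OF this dG[of 0]] show ?thesis by (simp add: d_def)
  qed
  \<comment> \<open>The added top term vanishes, as \<open>A x ^ n * E\<close> has order above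
    \<open>n\<close>. The \<open>i = 0\<close> term is zero as well, so an index shift turns
    \<open>i\<close> times \<open>P $ i\<close> into the coefficients of
    \<open>fps_deriv P\<close>.\<close>
  have "(\<Sum>i=0..n. P $ i * (of_nat i * A x ^ (i - 1) * E) $ n)
      = (\<Sum>i=0..Suc n. P $ i * (of_nat i * A x ^ (i - 1) * E) $ n)"
  proof -
    have "(A x ^ n * E) $ n = 0"
      unfolding fps_mult_nth
      by (rule sum.neutral)
        (use A0 E0 startsby_zero_power_prefix in \<open>force simp: le_less\<close>)
    then have "(of_nat (Suc n) * A x ^ n * E) $ n = 0"
      by (metis fps_mult_of_nat_nth(1) mult.assoc mult_zero_right)
    then show ?thesis by simp
  qed
  also have "\<dots> = (\<Sum>i=0..n. fps_deriv P $ i * (A x ^ i * E) $ n)"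
    unfolding sum.atLeast0_atMost_Suc_shift
    by (simp add: mult.assoc fps_mult_of_nat_nth mult.left_commute del: of_nat_Suc)
  also have "\<dots> = ((fps_deriv P oo A x) * E) $ n"
    by (rule fps_compose_mult_nth[OF A0, symmetric])
  finally have second: "(\<Sum>i=0..n. P $ i * (of_nat i * A x ^ (i - 1) * E) $ n)
      = ((fps_deriv P oo A x) * E) $ n" .
  have "fps_deriv (P oo A x) = (fps_deriv P oo A x) * (fps_const d + E)"
    by (simp add: fps_compose_deriv[OF A0]) (simp add: A_def E_def)
  then have "fps_deriv (P oo A x) $ n
      = (\<Sum>i=0..n. fps_deriv P $ i * d * (A x ^ i) $ n)
        + (\<Sum>i=0..n. P $ i * (of_nat i * A x ^ (i - 1) * E) $ n)"
    unfolding second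
    by (simp only: distrib_left fps_add_nth fps_mult_right_const_nth fps_compose_nth
        sum_distrib_right mult.assoc mult.commute[of d])
  moreover have "((\<lambda>x. (F (G x $ 0) oo A x) $ n) has_real_derivative
      (\<Sum>i=0..n. fps_deriv P $ i * d * (A x ^ i) $ n
        + P $ i * (of_nat i * A x ^ (i - 1) * E) $ n)) (at x)"
    unfolding fps_compose_nth
  proof (rule DERIV_sum)
    fix i
    show "((\<lambda>x. F (G x $ 0) $ i * (A x ^ i) $ n) has_real_derivative
        fps_deriv P $ i * d * (A x ^ i) $ n + P $ i * (of_nat i * A x ^ (i - 1) * E) $ n) (at x)"
      using DERIV_mult[OF dF[of i] has_real_derivative_fps_power_nth[OF dA, of i n]]
      by (simp add: P_def mult_ac)
  qed
  ultimately show "((\<lambda>x. (F (G x $ 0) oo (G x - fps_const (G x $ 0))) $ n) has_real_derivative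
      fps_deriv (F (G x $ 0) oo (G x - fps_const (G x $ 0))) $ n) (at x)"
    by (simp add: P_def A_def sum.distrib)
qed

text \<open>The composed Taylor series and the series of the identity are both Taylor families with
  constant coefficient \<open>x\<close>, hence equal. Cancelling the constant terms leaves
  \<open>fps_X\<close>.\<close>

lemma taylor0_compose_inverse:
  assumes "open S" "smooth_on T f" "smooth_on S g"
    and "\<And>x. x \<in> S \<Longrightarrow> g x \<in> T" "\<And>x. x \<in> S \<Longrightarrow> f (g x) = x" "x \<in> S"
  shows "taylor0 f (g x) oo taylor0 g x = fps_X"
proof -
  have "taylor f (g x) oo taylor0 g x = fps_const x + fps_X"
  proof (rule taylor_family_unique[OF \<open>open S\<close> _ taylor_family_id _ \<open>x \<in> S\<close>])
    show "taylor_family S (\<lambda>x. taylor f (g x) oo taylor0 g x)"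
      using taylor_family_compose[OF taylor_family_taylor[OF assms(2)]
          taylor_family_taylor[OF assms(3)]] assms(4)
      by (simp add: taylor0_def)
  qed (simp add: assms(5))
  then show ?thesis
    using assms(5,6) by (simp add: taylor0_def[of f] fps_compose_sub_distrib)
qed

section \<open>Compositae as coefficients of powers\<close>

lemma composita_eq_power_nth:
  assumes "1 \<le> k"
  shows "composita h n k x = (taylor0 h x ^ k) $ n"
proof -
  have "(taylor0 h x ^ k) $ n = (\<Sum>v\<in>natpermute n k. \<Prod>j=0..k - 1. taylor0 h x $ (v ! j))"
    using assms by (simp add: fps_power_nth)
  also have "\<dots> = (\<Sum>v\<in>natpermute n k. \<Prod>l\<leftarrow>v. taylor0 h x $ l)"
  proof (rule sum.cong[OF refl])
    fix v assume "v \<in> natpermute n k"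
    then have "length v = k" by (simp add: natpermute_def)
    moreover have "{0..k - 1} = {0..<k}" using assms by auto
    ultimately show "(\<Prod>j=0..k - 1. taylor0 h x $ (v ! j)) = (\<Prod>l\<leftarrow>v. taylor0 h x $ l)"
      by (simp add: prod.list_conv_set_nth)
  qed
  \<comment> \<open>\<open>natpermute\<close> also admits zero parts; such lists contribute nothing
    because \<open>taylor0 h x\<close> has no constant term.\<close>
  also have "\<dots> = (\<Sum>v\<in>compositions n k. \<Prod>l\<leftarrow>v. taylor0 h x $ l)"
  proof (rule sum.mono_neutral_right)
    show "\<forall>v\<in>natpermute n k - compositions n k. (\<Prod>l\<leftarrow>v. taylor0 h x $ l) = 0"
    proof
      fix v assume "v \<in> natpermute n k - compositions n k"
      then have "0 \<in> set v"
        by (auto simp: natpermute_def compositions_def not_less_eq_eq)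
      then have "0 \<in> set (map (\<lambda>l. taylor0 h x $ l) v)" by force
      then show "(\<Prod>l\<leftarrow>v. taylor0 h x $ l) = 0"
        by (simp only: prod_list_zero_iff)
    qed
  qed (use natpermute_finite in \<open>auto simp: natpermute_def compositions_def\<close>)
  also have "\<dots> = composita h n k x"
    unfolding composita_def
  proof (rule sum.cong[OF refl])
    fix v assume v: "v \<in> compositions n k"
    show "(\<Prod>l\<leftarrow>v. taylor0 h x $ l) = (\<Prod>l\<leftarrow>v. (deriv ^^ l) h x / fact l)"
    proof (rule arg_cong[where f = prod_list], rule map_cong[OF refl])
      fix l assume "l \<in> set v"
      with v have "1 \<le> l" by (auto simp: compositions_def)
      then show "taylor0 h x $ l = (deriv ^^ l) h x / fact l"
        by (simp add: taylor0_def taylor_def)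
    qed
  qed
  finally show ?thesis by simp
qed

text \<open>Viewed as triangular matrices, the compositae are inverse to each other: the sum is
  coefficient \<open>n\<close> of \<open>(taylor0 f u oo taylor0 g x) ^ m\<close>, that is, of
  \<open>fps_X ^ m\<close>.\<close>

lemma sum_composita_inverse:
  assumes "taylor0 f u oo taylor0 g x = fps_X" "1 \<le> m"
  shows "(\<Sum>k=m..n. composita g n k x * composita f k m u) = (if n = m then 1 else 0)"
proof -
  have "(\<Sum>k=m..n. composita g n k x * composita f k m u)
      = (\<Sum>k=m..n. (taylor0 f u ^ m) $ k * (taylor0 g x ^ k) $ n)"
    using \<open>1 \<le> m\<close> by (intro sum.cong) (auto simp: composita_eq_power_nth)
  \<comment> \<open>The terms with \<open>k < m\<close> vanish, since \<open>taylor0 f u ^ m\<close>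
    starts at degree \<open>m\<close>.\<close>
  also have "\<dots> = (\<Sum>k=0..n. (taylor0 f u ^ m) $ k * (taylor0 g x ^ k) $ n)"
    by (rule sum.mono_neutral_left) (auto simp: startsby_zero_power_prefix)
  also have "\<dots> = (taylor0 f u ^ m oo taylor0 g x) $ n"
    by (simp add: fps_compose_nth)
  also have "taylor0 f u ^ m oo taylor0 g x = fps_X ^ m"
    using assms(1) by (metis fps_compose_power taylor0_nth_0)
  finally show ?thesis by (simp add: fps_X_power_nth)
qed

section \<open>The two recurrences\<close>

theorem theorem4p1:
  fixes I J :: "real set" and f y :: "real \<Rightarrow> real" and n m :: nat
  assumes "open I" "is_interval I" "open J" "is_interval J"
    and "bij_betw f I J"
    and "\<And>x. x \<in> J \<Longrightarrow> y x = inv_into I f x"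
    and "smooth_on I f" "smooth_on J y"
    and "1 \<le> m" "m \<le> n"
  shows "(\<forall>x\<in>J. composita y n m x =
           (if n = m then 1 / composita f m m (y x)
            else - (1 / composita f m m (y x)) *
                 (\<Sum>k=m+1..n. composita y n k x * composita f k m (y x))))
    \<and> (\<forall>x\<in>I. composita y n m (f x) =
           (if n = m then 1 / composita f n n x
            else - (1 / composita f n n x) *
                 (\<Sum>k=m..n-1. composita f n k x * composita y k m (f x))))"
proof (intro conjI ballI)
  have fI: "f x \<in> J" if "x \<in> I" for x
    using that assms(5) by (auto simp: bij_betw_def)
  have yJ: "y x \<in> I" "f (y x) = x" if "x \<in> J" for x
    using that assms(5,6) by (auto simp: bij_betw_def inv_into_into f_inv_into_f)
  have yf: "y (f x) = x" if "x \<in> I" for x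
    using that fI assms(5,6) by (simp add: bij_betw_def)
  fix x
  {
    assume "x \<in> J"
    \<comment> \<open>Used twice: \<open>N = m\<close> gives the diagonal entry and shows that the
      divisor is nonzero; \<open>N = n\<close> gives the recurrence once the summand
      \<open>k = m\<close> is isolated.\<close>
    then have *: "(\<Sum>k=m..N. composita y N k x * composita f k m (y x)) = (if N = m then 1 else 0)"
      for N
      using taylor0_compose_inverse[OF \<open>open J\<close> assms(7,8)] yJ \<open>1 \<le> m\<close>
      by (intro sum_composita_inverse) auto
    have one: "composita y m m x * composita f m m (y x) = 1"
      using *[of m] by simp
    then have nz: "composita f m m (y x) \<noteq> 0" by auto
    show "composita y n m x =
           (if n = m then 1 / composita f m m (y x)
            else - (1 / composita f m m (y x)) *
                 (\<Sum>k=m+1..n. composita y n k x * composita f k m (y x)))"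
    proof (cases "n = m")
      case True
      with one nz show ?thesis by (simp add: field_simps)
    next
      case False
      with *[of n] \<open>m \<le> n\<close> have "composita y n m x * composita f m m (y x) +
          (\<Sum>k=m+1..n. composita y n k x * composita f k m (y x)) = 0"
        by (simp add: sum.atLeast_Suc_atMost)
      with False nz show ?thesis by (simp add: field_simps eq_neg_iff_add_eq_0)
    qed
  next
    assume "x \<in> I"
    \<comment> \<open>The matrix product in the other order, with \<open>f\<close> as inner and
      \<open>y\<close> as outer function. Now \<open>M = n\<close> gives the diagonal, and for
      \<open>M = m\<close> the last summand \<open>k = n\<close> is isolated.\<close>
    then have *: "(\<Sum>k=M..n. composita f n k x * composita y k M (f x)) = (if n = M then 1 else 0)"
      if "1 \<le> M" for M
      using taylor0_compose_inverse[OF \<open>open I\<close> assms(8,7)] fI yf that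
      by (intro sum_composita_inverse) auto
    have one: "composita f n n x * composita y n n (f x) = 1"
      using *[of n] \<open>1 \<le> m\<close> \<open>m \<le> n\<close> by simp
    then have nz: "composita f n n x \<noteq> 0" by auto
    show "composita y n m (f x) =
           (if n = m then 1 / composita f n n x
            else - (1 / composita f n n x) *
                 (\<Sum>k=m..n-1. composita f n k x * composita y k m (f x)))"
    proof (cases "n = m")
      case True
      with one nz show ?thesis by (simp add: field_simps)
    next
      case False
      then obtain N where N: "n = Suc N" "m \<le> N"
        using \<open>m \<le> n\<close> by (cases n) auto
      with *[of m] \<open>1 \<le> m\<close> False have "composita f n n x * composita y n m (f x) +
          (\<Sum>k=m..n-1. composita f n k x * composita y k m (f x)) = 0"
        by (simp add: add.commute)
      with False nz show ?thesis by (simp add: field_simps eq_neg_iff_add_eq_0)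
    qed
  }
qed

end
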